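(* Let $p,q\ge 0$ be integers and let $H_{p,q}(z,\overline{z})$ be the complex Hermite polynomial. Then a particular solution of the problem $$\overline{\partial}u(z,\overline{z})=H_{p,q}(z,\overline{z}),\qquad z\in\mathbb{C},$$ is given by $$u(z,\overline{z})=-\frac{1}{q+1}\sum_{k=1}^{q+1}(-1)^k\binom{q+1}{k}\overline{z}^kH_{p,q+1-k}(z,\overline{z}),\qquad\forall z\in\mathbb{C}.$$
   Context: $\overline{\partial}=\frac{\partial}{\partial\overline z}=\frac12\left(\frac{\partial}{\partial x}+i\frac{\partial}{\partial y}\right)$ for $z=x+iy$. For integers $m,n\ge0$, the complex Hermite (Itô) polynomials are $$H_{m,n}(z,\overline{z}):=\sum_{k=0}^{\min(m,n)}(-1)^kk!\binom{m}{k}\binom{n}{k}z^{m-k}\overline{z}^{n-k}.$$ *)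

theory Defs
  imports "HOL-Analysis.Analysis"
begin

definition dx :: "(complex \<Rightarrow> complex) \<Rightarrow> complex \<Rightarrow> complex" where
  "dx f z = vector_derivative (\<lambda>x. f (Complex x (Im z))) (at (Re z))"

definition dy :: "(complex \<Rightarrow> complex) \<Rightarrow> complex \<Rightarrow> complex" where
  "dy f z = vector_derivative (\<lambda>y. f (Complex (Re z) y)) (at (Im z))"

definition dbar :: "(complex \<Rightarrow> complex) \<Rightarrow> complex \<Rightarrow> complex" where
  "dbar f z = (dx f z + \<i> * dy f z) / 2"

(* Here differentiable is real (Frechet) differentiability on the real vector space complex.
   It makes both partial derivatives exist, so that dx and dy are not arbitrary values of
   vector_derivative. *)
definition dbar_solution :: "(complex \<Rightarrow> complex) \<Rightarrow> (complex \<Rightarrow> complex) \<Rightarrow> bool" where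
  "dbar_solution u f \<longleftrightarrow> (\<forall>z. u differentiable (at z) \<and> dbar u z = f z)"

(* The value of the polynomial at (z, cnj z), as a function of z alone. *)
definition complex_hermite :: "nat \<Rightarrow> nat \<Rightarrow> complex \<Rightarrow> complex" where
  "complex_hermite m n z =
     (\<Sum>k = 0..min m n. (-1) ^ k * fact k * of_nat (m choose k) * of_nat (n choose k)
        * z ^ (m - k) * cnj z ^ (n - k))"

end

theory Submission
  imports Defs
begin

text \<open>
  The polynomials \<open>H\<^sub>p\<^sub>,\<^sub>n\<close> form an Appell sequence for \<open>\<partial>/\<partial>(cnj z)\<close>, that is, the derivative of
  the \<open>n\<close>-th one is \<open>n\<close> times its predecessor. Hence the derivative of the full alternating sum over
  \<open>0 \<le> k \<le> q + 1\<close> telescopes to zero, and the sum over \<open>k \<ge> 1\<close> has the same derivative as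
  \<open>-H\<^sub>p\<^sub>,\<^sub>q\<^sub>+\<^sub>1\<close>, namely \<open>-(q + 1) H\<^sub>p\<^sub>,\<^sub>q\<close>.
\<close>

text \<open>Every real-linear map of the complex plane has the form \<open>a * h + d * cnj h\<close>
  for unique \<open>a\<close> and \<open>d\<close>, the two Wirtinger derivatives. Only
  \<open>d\<close> matters here, so \<open>a\<close> is hidden; real differentiability is carried
  along.\<close>

definition has_dbar :: "(complex \<Rightarrow> complex) \<Rightarrow> complex \<Rightarrow> complex \<Rightarrow> bool" where
  "has_dbar f d z \<longleftrightarrow> (\<exists>a. (f has_derivative (\<lambda>h. a * h + d * cnj h)) (at z))"

lemma has_dbar_differentiable: "has_dbar f d z \<Longrightarrow> f differentiable (at z)"
  unfolding has_dbar_def differentiable_def by blast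

text \<open>Along the real and imaginary directions the derivative takes the values
  \<open>a + d\<close> and \<open>\<i> * (a - d)\<close>, so \<open>a\<close> cancels in
  \<open>dx + \<i> * dy\<close> and \<open>2 * d\<close> remains.\<close>

lemma has_dbar_imp_dbar:
  assumes "has_dbar f d z"
  shows "dbar f z = d"
proof -
  obtain a where a: "(f has_derivative (\<lambda>h. a * h + d * cnj h)) (at z)"
    using assms unfolding has_dbar_def by blast
  have x: "((\<lambda>x. Complex x (Im z)) has_derivative (\<lambda>h. of_real h)) (at (Re z))"
    unfolding Complex_eq by (auto intro!: derivative_eq_intros)
  have y: "((\<lambda>y. Complex (Re z) y) has_derivative (\<lambda>h. \<i> * of_real h)) (at (Im z))"
    unfolding Complex_eq by (auto intro!: derivative_eq_intros)
  have "((\<lambda>x. f (Complex x (Im z))) has_derivative (\<lambda>h. a * of_real h + d * cnj (of_real h)))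
      (at (Re z))"
    by (rule has_derivative_compose[OF x]) (use a in simp)
  then have "((\<lambda>x. f (Complex x (Im z))) has_vector_derivative a + d) (at (Re z))"
    unfolding has_vector_derivative_def by (simp add: scaleR_conv_of_real algebra_simps)
  then have dx: "dx f z = a + d"
    unfolding dx_def by (rule vector_derivative_at)
  have "((\<lambda>y. f (Complex (Re z) y)) has_derivative
      (\<lambda>h. a * (\<i> * of_real h) + d * cnj (\<i> * of_real h))) (at (Im z))"
    by (rule has_derivative_compose[OF y]) (use a in simp)
  then have "((\<lambda>y. f (Complex (Re z) y)) has_vector_derivative \<i> * (a - d)) (at (Im z))"
    unfolding has_vector_derivative_def by (simp add: scaleR_conv_of_real algebra_simps)
  then have dy: "dy f z = \<i> * (a - d)"
    unfolding dy_def by (rule vector_derivative_at)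
  show ?thesis
    unfolding dbar_def dx dy by (simp add: algebra_simps flip: mult.assoc)
qed

lemma has_dbar_const: "has_dbar (\<lambda>z. c) 0 z"
  unfolding has_dbar_def by (rule exI[of _ 0]) simp

lemma has_dbar_id: "has_dbar (\<lambda>z. z) 0 z"
  unfolding has_dbar_def by (rule exI[of _ 1]) simp

lemma has_dbar_cnj: "has_dbar cnj 1 z"
  unfolding has_dbar_def
  by (rule exI[of _ 0]) (simp add: bounded_linear_cnj bounded_linear_imp_has_derivative)

lemma has_dbar_add:
  assumes "has_dbar f d z" "has_dbar g e z"
  shows "has_dbar (\<lambda>z. f z + g z) (d + e) z"
proof -
  obtain a b where "(f has_derivative (\<lambda>h. a * h + d * cnj h)) (at z)"
    "(g has_derivative (\<lambda>h. b * h + e * cnj h)) (at z)"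
    using assms unfolding has_dbar_def by blast
  from has_derivative_add[OF this] show ?thesis
    unfolding has_dbar_def by (intro exI[of _ "a + b"]) (simp add: algebra_simps)
qed

lemma has_dbar_mult:
  assumes "has_dbar f d z" "has_dbar g e z"
  shows "has_dbar (\<lambda>z. f z * g z) (d * g z + f z * e) z"
proof -
  obtain a b where "(f has_derivative (\<lambda>h. a * h + d * cnj h)) (at z)"
    "(g has_derivative (\<lambda>h. b * h + e * cnj h)) (at z)"
    using assms unfolding has_dbar_def by blast
  from has_derivative_mult[OF this] show ?thesis
    unfolding has_dbar_def
    by (intro exI[of _ "a * g z + f z * b"]) (simp add: algebra_simps)
qed

lemma has_dbar_cmult:
  assumes "has_dbar f d z"
  shows "has_dbar (\<lambda>z. c * f z) (c * d) z"
  using has_dbar_mult[OF has_dbar_const assms, of c] by simp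

lemma has_dbar_sum:
  assumes "\<And>k. k \<in> A \<Longrightarrow> has_dbar (f k) (d k) z"
  shows "has_dbar (\<lambda>z. \<Sum>k\<in>A. f k z) (\<Sum>k\<in>A. d k) z"
  using assms
  \<comment> \<open>For infinite \<open>A\<close> both sums are 0 by convention, which is the
    constant case.\<close>
  by (induction A rule: infinite_finite_induct) (auto intro: has_dbar_const has_dbar_add)

lemma has_dbar_power:
  assumes "has_dbar f d z"
  shows "has_dbar (\<lambda>z. f z ^ n) (of_nat n * f z ^ (n - 1) * d) z"
proof (induction n)
  case 0
  show ?case by (simp add: has_dbar_const)
next
  case (Suc n)
  \<comment> \<open>At \<open>n = 0\<close> the truncated exponent \<open>n - 1\<close> is harmless
    because of the factor \<open>of_nat n\<close>.\<close>
  have "d * f z ^ n + f z * (of_nat n * f z ^ (n - 1) * d) = of_nat (Suc n) * f z ^ n * d"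
    by (cases n) (simp_all add: algebra_simps)
  with has_dbar_mult[OF assms Suc] show ?case by simp
qed

text \<open>Beyond \<open>min m n\<close> one of the binomials vanishes. The free bound lets
  polynomials of different degree be summed over one range and compared termwise.\<close>

lemma complex_hermite_altdef:
  assumes "min m n \<le> N"
  shows "complex_hermite m n z =
    (\<Sum>k = 0..N. (-1) ^ k * fact k * of_nat (m choose k) * of_nat (n choose k)
       * z ^ (m - k) * cnj z ^ (n - k))"
  unfolding complex_hermite_def
  by (rule sum.mono_neutral_left) (use assms in \<open>auto simp: not_le binomial_eq_0\<close>)

lemma of_nat_diff_times_choose:
  "of_nat (n - k) * of_nat (n choose k) = (of_nat n * of_nat ((n - 1) choose k) :: 'a::comm_semiring_1)"
proof -
  have "(n - k) * (n choose k) = n * ((n - 1) choose k)"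
    by (rule binomial_absorb_comp)
  then show ?thesis by (metis of_nat_mult)
qed

text \<open>Only the powers of \<open>cnj z\<close> contribute, and
  \<open>(n - k) * (n choose k) = n * ((n - 1) choose k)\<close> turns each term into
  \<open>n\<close> times the matching term of the predecessor. For \<open>n = 0\<close> both sides
  of the termwise identity are 0.\<close>

lemma has_dbar_complex_hermite:
  "has_dbar (complex_hermite m n) (of_nat n * complex_hermite m (n - 1) z) z"
proof -
  define c :: "nat \<Rightarrow> complex" where "c k = (-1) ^ k * fact k * of_nat (m choose k)" for k
  have "has_dbar (\<lambda>z. c k * of_nat (n choose k) * (z ^ (m - k) * cnj z ^ (n - k)))
      (c k * of_nat (n choose k) *
        (z ^ (m - k) * (of_nat (n - k) * cnj z ^ (n - k - 1)))) z" for k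
  proof -
    \<comment> \<open>The factors 0 and 1 are the derivatives of \<open>z\<close> and
      \<open>cnj z\<close>, left unsimplified so that the rules unify.\<close>
    have "has_dbar (\<lambda>z. c k * of_nat (n choose k) * (z ^ (m - k) * cnj z ^ (n - k)))
        (c k * of_nat (n choose k) *
          ((of_nat (m - k) * z ^ (m - k - 1) * 0) * cnj z ^ (n - k) +
           z ^ (m - k) * (of_nat (n - k) * cnj z ^ (n - k - 1) * 1))) z"
      by (intro has_dbar_cmult has_dbar_mult has_dbar_power has_dbar_id has_dbar_cnj)
    then show ?thesis by simp
  qed
  then have "has_dbar (\<lambda>z. \<Sum>k = 0..n. c k * of_nat (n choose k) * (z ^ (m - k) * cnj z ^ (n - k)))
      (\<Sum>k = 0..n. c k * of_nat (n choose k) *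
        (z ^ (m - k) * (of_nat (n - k) * cnj z ^ (n - k - 1)))) z"
    by (rule has_dbar_sum)
  moreover have "complex_hermite m n =
      (\<lambda>z. \<Sum>k = 0..n. c k * of_nat (n choose k) * (z ^ (m - k) * cnj z ^ (n - k)))"
    by (rule ext) (simp add: complex_hermite_altdef[of m n n] c_def mult.assoc)
  moreover have "(\<Sum>k = 0..n. c k * of_nat (n choose k) *
      (z ^ (m - k) * (of_nat (n - k) * cnj z ^ (n - k - 1)))) =
      of_nat n * complex_hermite m (n - 1) z"
  proof -
    have "c k * of_nat (n choose k) * (z ^ (m - k) * (of_nat (n - k) * cnj z ^ (n - k - 1))) =
        of_nat n * (c k * of_nat ((n - 1) choose k) * z ^ (m - k) * cnj z ^ (n - 1 - k))" for k
    proof -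
      have "c k * of_nat (n choose k) * (z ^ (m - k) * (of_nat (n - k) * cnj z ^ (n - k - 1))) =
          c k * (of_nat (n - k) * of_nat (n choose k)) * (z ^ (m - k) * cnj z ^ (n - k - 1))"
        by (simp only: ac_simps)
      also have "\<dots> = of_nat n *
          (c k * of_nat ((n - 1) choose k) * z ^ (m - k) * cnj z ^ (n - 1 - k))"
        unfolding of_nat_diff_times_choose by (simp add: ac_simps)
      finally show ?thesis .
    qed
    then show ?thesis
      unfolding sum_distrib_left c_def
        complex_hermite_altdef[of m "n - 1" n, OF min.coboundedI2[OF diff_le_self]]
      by (intro sum.cong refl)
  qed
  ultimately show ?thesis by simp
qed

lemma has_dbar_alternating_sum:
  fixes N p :: nat
  shows "has_dbar (\<lambda>z. \<Sum>k = 0..N. (-1) ^ k * of_nat (N choose k) * cnj z ^ k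
                 * complex_hermite p (N - k) z) 0 z"
proof -
  define H where "H = complex_hermite p"
  define c :: "nat \<Rightarrow> complex" where "c k = (-1) ^ k * of_nat (N choose k)" for k
  \<comment> \<open>\<open>t k\<close> is the part of the derivative of the \<open>k\<close>-th summand coming from \<open>H\<close>; the part coming
    from \<open>cnj z ^ k\<close> cancels \<open>t (k - 1)\<close>.\<close>
  define t where "t k = c k * of_nat (N - k) * cnj z ^ k * H (N - k - 1) z" for k
  define s where "s k = c k * of_nat k * cnj z ^ (k - 1) * H (N - k) z" for k
  have "has_dbar (\<lambda>z. c k * (cnj z ^ k * H (N - k) z)) (s k + t k) z" for k
  proof -
    have "has_dbar (\<lambda>z. c k * (cnj z ^ k * H (N - k) z))
        (c k * ((of_nat k * cnj z ^ (k - 1) * 1) * H (N - k) z +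
          cnj z ^ k * (of_nat (N - k) * H (N - k - 1) z))) z"
      unfolding H_def
      by (intro has_dbar_cmult has_dbar_mult has_dbar_power has_dbar_cnj has_dbar_complex_hermite)
    then show ?thesis by (simp add: s_def t_def algebra_simps)
  qed
  then have *: "has_dbar (\<lambda>z. \<Sum>k = 0..N. c k * (cnj z ^ k * H (N - k) z))
      (\<Sum>k = 0..N. s k + t k) z"
    by (rule has_dbar_sum)
  have st: "s (Suc k) = - t k" for k
  proof -
    \<comment> \<open>Both sides equal \<open>N * ((N - 1) choose k)\<close>.\<close>
    have "Suc k * (N choose Suc k) = (N - k) * (N choose k)"
      by (metis binomial_absorb_comp binomial_absorption)
    then have "of_nat (N choose Suc k) * of_nat (Suc k) = (of_nat (N - k) * of_nat (N choose k) :: complex)"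
      by (metis mult.commute of_nat_mult)
    then show ?thesis
      by (simp add: s_def t_def c_def mult.assoc del: of_nat_Suc)
  qed
  \<comment> \<open>With \<open>N\<close> fixed, the partial sums telescope for every upper end
    \<open>M\<close>; the start \<open>s 0\<close> vanishes by its factor \<open>k\<close>, and at
    \<open>M = N\<close> the factor \<open>N - k\<close> kills \<open>t N\<close>.\<close>
  have "(\<Sum>k = 0..M. s k + t k) = t M" for M
    by (induction M) (simp_all add: st, simp add: s_def)
  also have "t N = 0" by (simp add: t_def)
  finally have "(\<Sum>k = 0..N. s k + t k) = 0" .
  with * show ?thesis by (simp add: c_def H_def mult.assoc)
qed

theorem proposition4p15:
  fixes p q :: nat
  shows "dbar_solution
           (\<lambda>z. - (1 / of_nat (q + 1)) *
              (\<Sum>k = 1..q + 1. (-1) ^ k * of_nat ((q + 1) choose k) * cnj z ^ k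
                 * complex_hermite p (q + 1 - k) z))
           (complex_hermite p q)"
proof -
  define N where "N = q + 1"
  define g where "g k z = (-1) ^ k * of_nat (N choose k) * cnj z ^ k * complex_hermite p (N - k) z"
    for k z
  have "has_dbar (\<lambda>z. - (1 / of_nat N) * (\<Sum>k = 1..N. g k z)) (complex_hermite p q z) z" for z
  proof -
    \<comment> \<open>The \<open>k = 0\<close> summand is \<open>complex_hermite p N z\<close>.
      Subtracting it from the full sum leaves the sum from 1, and its derivative is the only one to
      survive.\<close>
    have "has_dbar (\<lambda>z. - (1 / of_nat N) * ((\<Sum>k = 0..N. g k z) + (- 1) * complex_hermite p N z))
        (- (1 / of_nat N) * (0 + (- 1) * (of_nat N * complex_hermite p (N - 1) z))) z"
      unfolding g_def
      by (intro has_dbar_cmult has_dbar_add has_dbar_alternating_sum has_dbar_complex_hermite)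
    moreover have "(\<Sum>k = 0..N. g k z) + (- 1) * complex_hermite p N z = (\<Sum>k = 1..N. g k z)" for z
      by (simp add: sum.atLeast_Suc_atMost g_def)
    \<comment> \<open>Here \<open>N - 1 = q\<close>, and \<open>N = q + 1\<close> is nonzero, so the
      factor cancels.\<close>
    moreover have "- (1 / of_nat N) * (0 + (- 1) * (of_nat N * complex_hermite p (N - 1) z)) =
        complex_hermite p q z"
      by (simp add: N_def del: of_nat_add of_nat_Suc)
    ultimately show ?thesis by (simp only:)
  qed
  then show ?thesis
    unfolding dbar_solution_def g_def N_def
    by (blast intro: has_dbar_differentiable has_dbar_imp_dbar)
qed

end
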